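(* The quadratic entropy $S_Q(\rho)=1-\mathrm{Tr}(\rho^2)$ satisfies the firm subadditivity condition: for all bipartite systems $ab$ (all finite dimensions), all density operators $\rho_{ab}$, and all POVMs $P_a$ on $a$, $$S_Q(a:b)\ \geq\ \chi_Q(P_a,b).$$ Thus $S_Q$ has all four of the following properties. (i) For any bipartite state $\rho_{ab}$ and any POVM $P_a$ on $a$: $\chi_Q(P_a,b)\leq S_Q(a:b)$. (ii) For any bipartite state $\rho_{ab}$ with $\rho_a=\mathrm{Tr}_b(\rho_{ab})$ and any POVM $P_a$ on $a$: $\chi_Q(P_a,b)\leq S_Q(\rho_a)$. (iii) For any tripartite pure state $\rho_{abc}$ and any rank-1 POVM $N_a$ on $a$: $\chi_Q(N_a,b)\leq \chi_Q(N_a,bc)$. (iv) For any quantum channel $\mathcal{E}$ and any ensemble of pure states $\{p_j,|\psi_j\rangle\langle\psi_j|\}$: $\chi_Q(\{p_j,\mathcal{E}(|\psi_j\rangle\langle\psi_j|)\})\leq \chi_Q(\{p_j,|\psi_j\rangle\langle\psi_j|\})$.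
   Context: All Hilbert spaces are finite-dimensional. A state (density operator) is a positive semidefinite operator of trace one. For a bipartite state $\rho_{ab}$ on $\mathcal{H}_a\otimes\mathcal{H}_b$, $\rho_a=\mathrm{Tr}_b(\rho_{ab})$ and $\rho_b=\mathrm{Tr}_a(\rho_{ab})$ are the partial traces, and similarly for more parties. The quantum mutual information associated with $S_Q$ is $S_Q(a:b)=S_Q(\rho_a)+S_Q(\rho_b)-S_Q(\rho_{ab})$. A POVM $P_a=\{P_{aj}\}$ on $a$ is a finite collection of positive semidefinite operators on $\mathcal{H}_a$ with $\sum_j P_{aj}=I_a$; it is a rank-1 POVM, denoted $N_a=\{N_{aj}\}$, if all its elements are rank-1 operators. A quantum channel is a completely positive trace-preserving linear map. For an ensemble $\{p_j,\rho_j\}$ (finitely many density operators $\rho_j$ on a common space, with probabilities $p_j\ge 0$, $\sum_j p_j=1$), the Holevo quantity is $\chi_Q(\{p_j,\rho_j\})=S_Q(\sum_j p_j\rho_j)-\sum_j p_j S_Q(\rho_j)$. For a bipartite state $\rho_{ab}$ and POVM $P_a$ on $a$, $\chi_Q(P_a,b)$ is the Holevo quantity of the ensemble $\{p_j,\rho_{bj}\}$ given by $p_j=\mathrm{Tr}(P_{aj}\rho_a)$ and $p_j\rho_{bj}=\mathrm{Tr}_a[(P_{aj}\otimes I_b)\rho_{ab}]$ (terms with $p_j=0$ are omitted), i.e. $\chi_Q(P_a,b)=S_Q(\rho_b)-\sum_j p_jS_Q(\rho_{bj})$. For a tripartite state, $\chi_Q(P_a,bc)$ is defined in the same way with $bc$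 in place of $b$, and $\chi_Q(P_a,b)$ uses the reduced state $\rho_{ab}=\mathrm{Tr}_c(\rho_{abc})$. *)

theory Defs
  imports "HOL-Analysis.Analysis"
begin

text \<open>
  Operators on an \<open>n\<close>-dimensional Hilbert space are matrices \<open>complex^'n^'n\<close> with
  \<open>CARD('n) = n\<close>; the tensor product of the spaces indexed by \<open>'a\<close> and \<open>'b\<close> is indexed
  by \<open>'a \<times> 'b\<close>, and a threefold product by \<open>'a \<times> 'b \<times> 'c\<close>, i.e. \<open>'a \<times> ('b \<times> 'c)\<close>.
\<close>

definition cdot :: "complex^'n \<Rightarrow> complex^'n \<Rightarrow> complex" where
  "cdot u v = (\<Sum>i\<in>UNIV. cnj (u $ i) * v $ i)"

definition ketbra :: "complex^'n \<Rightarrow> complex^'n^'n" where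
  "ketbra v = (\<chi> i j. v $ i * cnj (v $ j))"

definition psd :: "complex^'n^'n \<Rightarrow> bool" where
  "psd A \<longleftrightarrow> (\<forall>v. cdot v (A *v v) \<in> \<real>\<^sub>\<ge>\<^sub>0)"

definition density_op :: "complex^'n^'n \<Rightarrow> bool" where
  "density_op \<rho> \<longleftrightarrow> psd \<rho> \<and> trace \<rho> = 1"

definition pure_state :: "complex^'n^'n \<Rightarrow> bool" where
  "pure_state \<rho> \<longleftrightarrow> (\<exists>\<psi>. norm \<psi> = 1 \<and> \<rho> = ketbra \<psi>)"

definition tensor :: "complex^'a^'a \<Rightarrow> complex^'b^'b \<Rightarrow> complex^('a \<times> 'b)^('a \<times> 'b)" where
  "tensor A B = (\<chi> x y. A $ fst x $ fst y * B $ snd x $ snd y)"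

text \<open>Partial traces: \<open>tr_fst\<close> and \<open>tr_snd\<close> trace out the first resp. second factor,
  \<open>tr_third\<close> the last factor of a threefold product.\<close>

definition tr_fst :: "complex^('a::finite \<times> 'b)^('a \<times> 'b) \<Rightarrow> complex^'b^'b" where
  "tr_fst \<rho> = (\<chi> j j'. \<Sum>i\<in>UNIV. \<rho> $ (i, j) $ (i, j'))"

definition tr_snd :: "complex^('a \<times> 'b::finite)^('a \<times> 'b) \<Rightarrow> complex^'a^'a" where
  "tr_snd \<rho> = (\<chi> i i'. \<Sum>j\<in>UNIV. \<rho> $ (i, j) $ (i', j))"

definition tr_third ::
    "complex^('a::finite \<times> 'b::finite \<times> 'c::finite)^('a \<times> 'b \<times> 'c) \<Rightarrow> complex^('a \<times> 'b)^('a \<times> 'b)" where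
  "tr_third \<rho> = (\<chi> x y. \<Sum>k\<in>UNIV. \<rho> $ (fst x, snd x, k) $ (fst y, snd y, k))"

text \<open>The trace is real for the Hermitian \<open>\<rho>\<close> of interest, so \<open>Re\<close> is only a coercion.\<close>

definition S_Q :: "complex^'n^'n \<Rightarrow> real" where
  "S_Q \<rho> = 1 - Re (trace (\<rho> ** \<rho>))"

definition mutual_info_Q :: "complex^('a::finite \<times> 'b::finite)^('a \<times> 'b) \<Rightarrow> real" where
  "mutual_info_Q \<rho> = S_Q (tr_snd \<rho>) + S_Q (tr_fst \<rho>) - S_Q \<rho>"

definition povm :: "'i set \<Rightarrow> ('i \<Rightarrow> complex^'a^'a) \<Rightarrow> bool" where
  "povm J P \<longleftrightarrow> finite J \<and> (\<forall>j\<in>J. psd (P j)) \<and> (\<Sum>j\<in>J. P j) = mat 1"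

definition rank1_povm :: "'i set \<Rightarrow> ('i \<Rightarrow> complex^'a^'a) \<Rightarrow> bool" where
  "rank1_povm J N \<longleftrightarrow> povm J N \<and> (\<forall>j\<in>J. rank (N j) = 1)"

definition ensemble :: "'i set \<Rightarrow> ('i \<Rightarrow> real) \<Rightarrow> ('i \<Rightarrow> complex^'n^'n) \<Rightarrow> bool" where
  "ensemble J p \<rho> \<longleftrightarrow> finite J \<and> (\<forall>j\<in>J. 0 \<le> p j) \<and> (\<Sum>j\<in>J. p j) = 1 \<and> (\<forall>j\<in>J. density_op (\<rho> j))"

definition holevo_Q :: "'i set \<Rightarrow> ('i \<Rightarrow> real) \<Rightarrow> ('i \<Rightarrow> complex^'n^'n) \<Rightarrow> real" where
  "holevo_Q J p \<rho> = S_Q (\<Sum>j\<in>J. p j *\<^sub>R \<rho> j) - (\<Sum>j\<in>J. p j * S_Q (\<rho> j))"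

definition outcome_prob ::
    "('i \<Rightarrow> complex^'a^'a) \<Rightarrow> complex^('a \<times> 'b::finite)^('a \<times> 'b) \<Rightarrow> 'i \<Rightarrow> real" where
  "outcome_prob P \<rho> j = Re (trace (P j ** tr_snd \<rho>))"

definition post_state ::
    "('i \<Rightarrow> complex^'a^'a) \<Rightarrow> complex^('a \<times> 'b)^('a \<times> 'b) \<Rightarrow> 'i \<Rightarrow> complex^'b^'b" where
  "post_state P \<rho> j =
     (1 / outcome_prob P \<rho> j) *\<^sub>R tr_fst (tensor (P j) (mat 1) ** \<rho>)"

definition chi_Q ::
    "'i set \<Rightarrow> ('i \<Rightarrow> complex^'a^'a) \<Rightarrow> complex^('a \<times> 'b::finite)^('a \<times> 'b) \<Rightarrow> real" where
  "chi_Q J P \<rho> =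
     holevo_Q {j \<in> J. outcome_prob P \<rho> j \<noteq> 0} (outcome_prob P \<rho>) (post_state P \<rho>)"

text \<open>
  Complete positivity says that \<open>id\<^sub>k \<otimes> E\<close> is positive for every \<open>k\<close>. Since \<open>k\<close> is quantified,
  an operator on \<open>\<complex>\<^sup>k \<otimes> H\<close> is given by its \<open>k \<times> k\<close> blocks \<open>X i j\<close> (\<open>i, j < k\<close>), which are
  operators on \<open>H\<close>, and a vector by its \<open>k\<close> components \<open>v i\<close> in \<open>H\<close>; the map \<open>id\<^sub>k \<otimes> E\<close> acts blockwise.
\<close>

definition block_psd :: "nat \<Rightarrow> (nat \<Rightarrow> nat \<Rightarrow> complex^'n^'n) \<Rightarrow> bool" where
  "block_psd k X \<longleftrightarrow> (\<forall>v. (\<Sum>i<k. \<Sum>j<k. cdot (v i) (X i j *v v j)) \<in> \<real>\<^sub>\<ge>\<^sub>0)"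

definition completely_positive :: "(complex^'m^'m \<Rightarrow> complex^'n^'n) \<Rightarrow> bool" where
  "completely_positive E \<longleftrightarrow> (\<forall>k X. block_psd k X \<longrightarrow> block_psd k (\<lambda>i j. E (X i j)))"

definition complex_linear_map :: "(complex^'m^'m \<Rightarrow> complex^'n^'n) \<Rightarrow> bool" where
  "complex_linear_map E \<longleftrightarrow>
     (\<forall>A B. E (A + B) = E A + E B) \<and> (\<forall>c A. E (mat c ** A) = mat c ** E A)"

definition quantum_channel :: "(complex^'m^'m \<Rightarrow> complex^'n^'n) \<Rightarrow> bool" where
  "quantum_channel E \<longleftrightarrow>
     complex_linear_map E \<and> completely_positive E \<and> (\<forall>A. trace (E A) = trace A)"

end

theory Submission
  imports Defs
begin

text \<open>
  Everything reduces to pairs of rank-one operators. Let \<open>F\<close> be a symmetric real bilinear form on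
  operators and \<open>R\<close> positive, with \<open>F(uu\<^sup>*, vv\<^sup>*) \<ge> 0\<close> and \<open>F(uu\<^sup>*, uu\<^sup>*) \<le> \<langle>u|R|u\<rangle>\<^sup>2\<close>.
  If \<open>u\<close>, \<open>v\<close> are normalised with respect to \<open>R\<close>, then \<open>uu\<^sup>* - vv\<^sup>*\<close> is a real multiple \<open>\<lambda>\<close> of
  \<open>ee\<^sup>* - ff\<^sup>*\<close> with \<open>e\<close>, \<open>f\<close> orthonormal with respect to \<open>R\<close> and \<open>\<lambda>\<^sup>2 = 1 - |\<langle>u|R|v\<rangle>|\<^sup>2\<close>, so \<open>F\<close> takes a
  value of at most \<open>2\<lambda>\<^sup>2\<close> on the difference. Averaging over all pairs of an ensemble, in the
  form of the variance identity, bounds the Holevo quantity.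

  For a channel \<open>E\<close> take \<open>R = 1\<close> and \<open>F(X, Y) = Tr E(X) E(Y)\<close>. For measurements take \<open>R = \<rho>\<^sub>a\<close>;
  then \<open>F(X, Y) = Tr (X \<otimes> 1) \<rho> (Y \<otimes> 1) \<rho>\<close> gives the mutual information bound and
  \<open>F(X, Y) = Tr (\<sigma>(X) \<sigma>(Y))\<close> with \<open>\<sigma>(X) = Tr\<^sub>a ((X \<otimes> 1) \<rho>)\<close> gives the bound by \<open>S\<^sub>Q(\<rho>\<^sub>a)\<close>. The
  tripartite statement follows from the latter, because \<open>\<chi>(N\<^sub>a, bc) = S\<^sub>Q(\<rho>\<^sub>a)\<close> for a pure state.
\<close>

subsection \<open>Positive semidefinite matrices\<close>

lemma cdot_add_left: "cdot (u + v) w = cdot u w + cdot v w"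
  and cdot_add_right: "cdot u (v + w) = cdot u v + cdot u w"
  and cdot_scale_left: "cdot (c *s u) v = cnj c * cdot u v"
  and cdot_scale_right: "cdot u (c *s v) = c * cdot u v"
  by (simp_all add: cdot_def algebra_simps sum.distrib sum_distrib_left)

lemma cdot_commute: "cdot v u = cnj (cdot u v)"
  by (simp add: cdot_def mult.commute)

lemma cdot_mat_vec: "cdot u (A *v v) = (\<Sum>i\<in>UNIV. \<Sum>j\<in>UNIV. cnj (u $ i) * A $ i $ j * v $ j)"
  by (simp add: cdot_def matrix_vector_mult_def sum_distrib_left mult.assoc)

lemma mat_vec_axis: "((A :: complex^'n^'m) *v axis i 1) $ k = A $ k $ i"
  by (simp add: matrix_vector_mult_def axis_def if_distrib cong: if_cong)

lemma cdot_axis: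
  fixes v :: "complex^'n"
  shows "cdot (axis i 1) v = v $ i"
proof -
  have "cnj ((axis i 1 :: complex^'n) $ k) = (if k = i then 1 else 0)" for k
    by (simp add: axis_def)
  then show ?thesis
    by (simp add: cdot_def if_distrib[where f = "\<lambda>x. x * y" for y] cong: if_cong)
qed

lemma cdot_mat_vec_axis: "cdot (axis i 1) (A *v axis j 1) = A $ i $ j"
  by (simp add: cdot_axis mat_vec_axis)

lemma psdD: "psd A \<Longrightarrow> 0 \<le> Re (cdot v (A *v v))" "psd A \<Longrightarrow> Im (cdot v (A *v v)) = 0"
  by (auto simp: psd_def complex_nonneg_Reals_iff)

lemma psdI: "(\<And>v. 0 \<le> Re (cdot v (A *v v))) \<Longrightarrow> (\<And>v. Im (cdot v (A *v v)) = 0) \<Longrightarrow> psd A"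
  by (auto simp: psd_def complex_nonneg_Reals_iff)

lemma psd_form: "psd A \<Longrightarrow> cdot v (A *v v) = of_real (Re (cdot v (A *v v)))"
  using psdD by (simp add: complex_eq_iff)

lemma cdot_form_add:
  "cdot (u + c *s v) (A *v (u + c *s v)) = cdot u (A *v u) + c * cdot u (A *v v)
     + cnj c * cdot v (A *v u) + of_real ((cmod c)\<^sup>2) * cdot v (A *v v)"
  unfolding complex_norm_square
  by (simp add: cdot_add_left cdot_add_right cdot_scale_left cdot_scale_right
      matrix_vector_right_distrib vector_scalar_commute algebra_simps)

text \<open>By polarization: the form is real at \<open>u + v\<close> and at \<open>u + i v\<close>,
  which gives equality of the imaginary parts and of the real parts respectively.\<close>

lemma psd_hermitian:
  assumes "psd A"
  shows "cdot v (A *v u) = cnj (cdot u (A *v v))"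
proof -
  have "Im (cdot (u + 1 *s v) (A *v (u + 1 *s v))) = 0" "Im (cdot (u + \<i> *s v) (A *v (u + \<i> *s v))) = 0"
    using psdD(2)[OF assms] by blast+
  then show ?thesis
    unfolding cdot_form_add using psdD(2)[OF assms] by (simp add: complex_eq_iff)
qed

lemma psd_hermitian_entry: "psd A \<Longrightarrow> A $ j $ i = cnj (A $ i $ j)"
  using psd_hermitian[of A "axis j 1" "axis i 1"] by (simp add: cdot_mat_vec_axis)

text \<open>Along \<open>u + (t * cnj b) *s v\<close>, where \<open>b = cdot u (A *v v)\<close>, the
  form is a nonnegative quadratic in the real \<open>t\<close>. For \<open>r > 0\<close> its value
  at \<open>t = - 1 / r\<close> is \<open>p - |b|^2 / r\<close>.\<close>

lemma psd_Cauchy_Schwarz: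
  assumes "psd A"
  shows "(cmod (cdot u (A *v v)))\<^sup>2 \<le> Re (cdot u (A *v u)) * Re (cdot v (A *v v))"
proof -
  define b p r where "b = cdot u (A *v v)" and "p = Re (cdot u (A *v u))" and "r = Re (cdot v (A *v v))"
  have r: "0 \<le> r" and p: "0 \<le> p"
    unfolding r_def p_def using psdD(1)[OF assms] by blast+
  have main: "0 \<le> p + 2 * t * (cmod b)\<^sup>2 + t\<^sup>2 * (cmod b)\<^sup>2 * r" for t
  proof -
    have "0 \<le> Re (cdot (u + (of_real t * cnj b) *s v) (A *v (u + (of_real t * cnj b) *s v)))"
      using psdD(1)[OF assms] by blast
    also have "\<dots> = p + 2 * t * (cmod b)\<^sup>2 + t\<^sup>2 * (cmod b)\<^sup>2 * r"
      unfolding cdot_form_add psd_hermitian[OF assms, of v u] b_def[symmetric] p_def r_def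
      by (simp add: norm_mult power_mult_distrib cmod_power2 algebra_simps) (simp add: power2_eq_square algebra_simps)
    finally show ?thesis .
  qed
  have "(cmod b)\<^sup>2 \<le> p * r"
  proof (cases "r = 0")
    case True
    have "(cmod b)\<^sup>2 = 0"
    proof (rule ccontr)
      assume ne: "(cmod b)\<^sup>2 \<noteq> 0"
      \<comment> \<open>For \<open>r = 0\<close> the quadratic is affine in \<open>t\<close>, and
        this \<open>t\<close> gives it the value -1.\<close>
      have "p + 2 * (- (p + 1) / (2 * (cmod b)\<^sup>2)) * (cmod b)\<^sup>2 = - 1"
        using ne by (simp add: field_simps)
      with main[of "- (p + 1) / (2 * (cmod b)\<^sup>2)"] True show False by simp
    qed
    with True show ?thesis by simp
  next
    case False
    have "0 \<le> p - (cmod b)\<^sup>2 / r"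
      using main[of "- 1 / r"] False by (simp add: field_simps power2_eq_square)
    then show ?thesis using False r by (simp add: field_simps)
  qed
  then show ?thesis by (simp add: b_def p_def r_def)
qed

section \<open>Rank-one operators and decompositions into them\<close>

lemma cdot_ketbra: "cdot u (ketbra w *v v) = cdot u w * cdot w v"
  unfolding cdot_mat_vec by (simp add: cdot_def ketbra_def sum_product mult.assoc)

lemma ketbra_scale: "ketbra (c *s v) = (cmod c)\<^sup>2 *\<^sub>R ketbra v"
  unfolding vec_eq_iff ketbra_def
  by (simp add: scaleR_conv_of_real[where 'a = complex] complex_norm_square del: of_real_power)

lemma ketbra_zero [simp]: "ketbra 0 = 0"
  by (simp add: ketbra_def vec_eq_iff)

lemma cdot_diff_mat: "cdot u ((A - B) *v v) = cdot u (A *v v) - cdot u (B *v v)"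
  and cdot_add_mat: "cdot u ((A + B) *v v) = cdot u (A *v v) + cdot u (B *v v)"
  and cdot_scale_mat: "cdot u ((r *\<^sub>R A) *v v) = of_real r * cdot u (A *v v)"
  unfolding cdot_mat_vec
  by (simp_all add: algebra_simps sum.distrib sum_subtractf sum_distrib_left scaleR_conv_of_real[where 'a = complex])

lemma psd_ketbra: "psd (ketbra w)"
  by (rule psdI) (simp_all add: cdot_ketbra cdot_commute[of w] flip: complex_norm_square)

lemma psd_add: "psd A \<Longrightarrow> psd B \<Longrightarrow> psd (A + B)"
  using psdD[of A] psdD[of B] by (intro psdI) (simp_all add: cdot_add_mat)

lemma psd_zero: "psd 0"
  by (simp add: psd_def cdot_def)

lemma psd_sum: "(\<And>i. i \<in> I \<Longrightarrow> psd (A i)) \<Longrightarrow> psd (\<Sum>i\<in>I. A i)"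
  by (induction I rule: infinite_finite_induct) (simp_all add: psd_zero psd_add)

text \<open>A step of the outer-product Cholesky factorisation, which eliminates row and column \<open>i\<close>.\<close>

lemma psd_Cholesky_step:
  fixes i :: "'n::finite"
  assumes "psd A"
  defines "w \<equiv> of_real (1 / sqrt (Re (A $ i $ i))) *s (A *v axis i 1)"
  shows "psd (A - ketbra w)"
    and "Re (A $ i $ i) \<noteq> 0 \<Longrightarrow> ketbra w $ k $ l = A $ k $ i * A $ i $ l / A $ i $ i"
proof -
  have pos: "0 \<le> Re (A $ i $ i)" and real: "A $ i $ i = of_real (Re (A $ i $ i))"
    using psdD(1)[OF assms(1), of "axis i 1"] psd_form[OF assms(1), of "axis i 1"]
    by (simp_all add: cdot_mat_vec_axis)
  have kb: "ketbra w = (1 / Re (A $ i $ i)) *\<^sub>R ketbra (A *v axis i 1)"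
    unfolding w_def ketbra_scale using pos by (simp add: norm_divide power_divide)
  have form: "cdot v (ketbra w *v v) = of_real ((cmod (cdot v (A *v axis i 1)))\<^sup>2 / Re (A $ i $ i))" for v
    unfolding kb cdot_scale_mat cdot_ketbra cdot_commute[of "A *v axis i 1" v]
    by (simp flip: complex_norm_square)
  show "psd (A - ketbra w)"
  proof (rule psdI)
    fix v
    \<comment> \<open>Cauchy-Schwarz against the basis vector \<open>axis i 1\<close>. A zero pivot
      makes the left side 0 through division by zero.\<close>
    have "(cmod (cdot v (A *v axis i 1)))\<^sup>2 / Re (A $ i $ i) \<le> Re (cdot v (A *v v))"
      using psd_Cauchy_Schwarz[OF assms(1), of v "axis i 1"] pos psdD(1)[OF assms(1), of v]
      by (cases "Re (A $ i $ i) = 0") (simp_all add: cdot_mat_vec_axis field_simps)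
    then show "0 \<le> Re (cdot v ((A - ketbra w) *v v))"
      unfolding cdot_diff_mat form by simp
    show "Im (cdot v ((A - ketbra w) *v v)) = 0"
      unfolding cdot_diff_mat form using psdD(2)[OF assms(1)] by simp
  qed
  show "ketbra w $ k $ l = A $ k $ i * A $ i $ l / A $ i $ i" if "Re (A $ i $ i) \<noteq> 0"
    unfolding kb using psd_hermitian_entry[OF assms(1), of i l] real
    by (simp add: ketbra_def mat_vec_axis scaleR_conv_of_real[where 'a = complex])
qed

text \<open>Cauchy-Schwarz on basis vectors bounds |A_ik|^2 by A_ii A_kk.\<close>

lemma psd_diag_zero:
  assumes "psd A" and "A $ i $ i = 0"
  shows "A $ i $ k = 0" and "A $ k $ i = 0"
proof -
  show "A $ i $ k = 0"
    using psd_Cauchy_Schwarz[OF assms(1), of "axis i 1" "axis k 1"] assms(2) by (simp add: cdot_mat_vec_axis)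
  then show "A $ k $ i = 0"
    using psd_hermitian_entry[OF assms(1)] by (metis complex_cnj_zero)
qed

text \<open>Each Cholesky step removes one index from the support of the diagonal, and a positive
  semidefinite matrix with zero diagonal vanishes. The vectors may be zero or linearly
  dependent.\<close>

lemma psd_eq_sum_ketbra_on:
  assumes "finite S" and "psd A" and "\<And>i. i \<notin> S \<Longrightarrow> A $ i $ i = 0"
  shows "\<exists>w. A = (\<Sum>i\<in>S. ketbra (w i))"
  using assms
proof (induction S arbitrary: A rule: finite_induct)
  case empty
  then show ?case
    using psd_diag_zero(1) by (fastforce simp: vec_eq_iff)
next
  case (insert i S)
  define w where "w = of_real (1 / sqrt (Re (A $ i $ i))) *s (A *v axis i 1)"
  have real: "A $ i $ i = of_real (Re (A $ i $ i))"
    using psd_form[OF insert.prems(1), of "axis i 1"] by (simp add: cdot_mat_vec_axis)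
  have psd': "psd (A - ketbra w)"
    unfolding w_def by (rule psd_Cholesky_step[OF insert.prems(1)])
  \<comment> \<open>At \<open>i\<close> the step subtracts exactly the pivot; at any other index
    outside \<open>S\<close> the entry of column \<open>i\<close> is already zero, so nothing
    changes there.\<close>
  have diag': "(A - ketbra w) $ k $ k = 0" if "k \<notin> S" for k
  proof (cases "Re (A $ i $ i) = 0")
    case True
    then have "w = 0" and "A $ i $ i = 0"
      using real by (simp_all add: w_def)
    with that insert.prems(2) show ?thesis by (cases "k = i") auto
  next
    case False
    have "ketbra w $ k $ k = A $ k $ i * A $ i $ k / A $ i $ i"
      unfolding w_def by (rule psd_Cholesky_step(2)[OF insert.prems(1) False])
    moreover have "A $ i $ i \<noteq> 0" using False by auto
    moreover have "A $ k $ i = 0" "A $ k $ k = 0" if "k \<noteq> i"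
    proof -
      show "A $ k $ k = 0" using insert.prems(2) \<open>k \<notin> S\<close> that by simp
      then show "A $ k $ i = 0" by (rule psd_diag_zero(1)[OF insert.prems(1)])
    qed
    ultimately show ?thesis by (cases "k = i") auto
  qed
  obtain z where z: "A - ketbra w = (\<Sum>i\<in>S. ketbra (z i))"
    using insert.IH[OF psd' diag'] by blast
  have "A = ketbra w + (\<Sum>j\<in>S. ketbra (z j))" using z by (simp add: algebra_simps)
  also have "\<dots> = (\<Sum>j\<in>insert i S. ketbra ((z(i := w)) j))"
    using insert.hyps by (simp, intro sum.cong) auto
  finally show ?case by blast
qed

corollary psd_eq_sum_ketbra:
  fixes A :: "complex^'n^'n"
  assumes "psd A"
  obtains w :: "'n \<Rightarrow> complex^'n" where "A = (\<Sum>i\<in>UNIV. ketbra (w i))"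
  using psd_eq_sum_ketbra_on[of UNIV A] assms by auto

text \<open>All rows are multiples of one vector, so a single Cholesky step at a nonzero pivot
  already reproduces the whole matrix.\<close>

lemma psd_rank1_eq_ketbra:
  assumes "psd A" and "rank A = 1"
  obtains w where "A = ketbra w"
proof -
  obtain B where B: "B \<subseteq> rows A" "vec.independent B" "rows A \<subseteq> vec.span B" "card B = vec.dim (rows A)"
    by (rule vec.basis_exists)
  have "card B = 1" using B(4) assms(2) by (simp add: row_rank_def_gen)
  then obtain x where "B = {x}" by (auto simp: card_1_singleton_iff)
  then have "\<forall>k. \<exists>c. A $ k = c *s x"
    using B(3) by (auto simp: rows_def row_def vec.span_singleton)
  then obtain y where y: "\<And>k. A $ k = y k *s x" by metis
  have "x \<noteq> 0" using B(2) \<open>B = {x}\<close> vec.dependent_zero by blast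
  moreover have "x \<in> rows A" using B(1) \<open>B = {x}\<close> by simp
  ultimately have "A \<noteq> 0" by (force simp: rows_def row_def vec_eq_iff)
  then obtain i where i: "A $ i $ i \<noteq> 0"
    using psd_diag_zero(1)[OF assms(1)] by (metis vec_eq_iff zero_index)
  moreover have "Im (A $ i $ i) = 0"
    using psdD(2)[OF assms(1), of "axis i 1"] by (simp add: cdot_mat_vec_axis)
  ultimately have ne: "Re (A $ i $ i) \<noteq> 0" by (simp add: complex_eq_iff)
  have "A $ k $ i * A $ i $ l / A $ i $ i = A $ k $ l" for k l
    using i by (simp add: y)
  then have "A = ketbra (of_real (1 / sqrt (Re (A $ i $ i))) *s (A *v axis i 1))"
    unfolding vec_eq_iff psd_Cholesky_step(2)[OF assms(1) ne] by simp
  with that show thesis by blast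
qed

subsection \<open>Traces\<close>

lemma linear_matrix_mult_right: "linear (\<lambda>X :: complex^'n^'m. A ** X)"
  and linear_matrix_mult_left: "linear (\<lambda>X :: complex^'m^'n. X ** B)"
  by (rule linearI;
      simp add: matrix_matrix_mult_def vec_eq_iff algebra_simps sum.distrib scaleR_conv_of_real[where 'a = complex]
        sum_distrib_left)+

lemma linear_Re_trace: "linear (\<lambda>X :: complex^'n^'n. Re (trace X))"
  by (rule linearI) (simp_all add: trace_def sum.distrib sum_distrib_left)

lemma trace_mult: "trace (A ** B) = (\<Sum>i\<in>UNIV. \<Sum>j\<in>UNIV. A $ i $ j * B $ j $ i)"
  by (simp add: trace_def matrix_matrix_mult_def)

lemma ketbra_mat_vec: "ketbra u *v x = cdot u x *s u"
  by (simp add: vec_eq_iff matrix_vector_mult_def ketbra_def cdot_def sum_distrib_left mult_ac)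

lemma trace_mult_ketbra: "trace (A ** ketbra u) = cdot u (A *v u)"
  unfolding trace_mult cdot_mat_vec by (simp add: ketbra_def mult_ac)

lemma trace_mult_ketbra2: "trace (A ** ketbra u ** B ** ketbra v) = cdot v (A *v u) * cdot u (B *v v)"
  unfolding trace_mult_ketbra
  by (simp add: ketbra_mat_vec vector_scalar_commute cdot_scale_right mult.commute flip: matrix_vector_mul_assoc)

lemma Re_trace_psd_mult_nonneg:
  fixes A B :: "complex^'n^'n"
  assumes "psd A" and "psd B"
  shows "0 \<le> Re (trace (A ** B))"
proof -
  obtain w :: "'n \<Rightarrow> complex^'n" where "B = (\<Sum>i\<in>UNIV. ketbra (w i))" by (rule psd_eq_sum_ketbra[OF assms(2)])
  then have "Re (trace (A ** B)) = (\<Sum>i\<in>UNIV. Re (cdot (w i) (A *v w i)))"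
    by (simp add: linear_sum[OF linear_matrix_mult_right] linear_sum[OF linear_Re_trace] trace_mult_ketbra)
  then show ?thesis by (simp add: sum_nonneg psdD(1)[OF assms(1)])
qed

lemma Re_trace_psd_square:
  assumes "psd A"
  shows "Re (trace (A ** A)) = (\<Sum>i\<in>UNIV. \<Sum>j\<in>UNIV. (cmod (A $ i $ j))\<^sup>2)"
proof -
  have "Re (A $ i $ j * A $ j $ i) = (cmod (A $ i $ j))\<^sup>2" for i j
    using psd_hermitian_entry[OF assms, of j i] by (simp flip: complex_norm_square)
  then show ?thesis by (simp add: trace_mult)
qed

text \<open>The norm of a vector of vectors is the Hilbert-Schmidt norm, so purities can be handled
  by norm inequalities.\<close>

lemma norm_psd_square: "psd A \<Longrightarrow> (norm A)\<^sup>2 = Re (trace (A ** A))"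
  by (simp add: Re_trace_psd_square norm_vec_def L2_set_def sum_nonneg)

lemma Re_trace_psd_nonneg: "psd A \<Longrightarrow> 0 \<le> Re (trace A)"
  using psdD(1)[of A "axis _ 1"] by (simp add: trace_def cdot_mat_vec_axis sum_nonneg)

lemma Im_trace_psd: "psd A \<Longrightarrow> Im (trace A) = 0"
  using psdD(2)[of A "axis _ 1"] by (simp add: trace_def cdot_mat_vec_axis)

text \<open>Summing |A_ij|^2 \<le> A_ii A_jj over all entries gives Tr A^2 \<le> (Tr A)^2.\<close>

lemma norm_psd_le_trace:
  assumes "psd A"
  shows "norm A \<le> Re (trace A)"
proof -
  have "(cmod (A $ i $ j))\<^sup>2 \<le> Re (A $ i $ i) * Re (A $ j $ j)" for i j
    using psd_Cauchy_Schwarz[OF assms, of "axis i 1" "axis j 1"] by (simp add: cdot_mat_vec_axis)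
  then have "(norm A)\<^sup>2 \<le> (\<Sum>i\<in>UNIV. \<Sum>j\<in>UNIV. Re (A $ i $ i) * Re (A $ j $ j))"
    unfolding norm_psd_square[OF assms] Re_trace_psd_square[OF assms] by (intro sum_mono)
  also have "\<dots> = (Re (trace A))\<^sup>2"
    by (simp add: trace_def power2_eq_square sum_product)
  finally show ?thesis
    using Re_trace_psd_nonneg[OF assms] by (rule power2_le_imp_le)
qed

subsection \<open>The pairwise purity bound\<close>

text \<open>With \<open>R\<close> the reduced state on a, this is the probability of the effect
  \<open>ketbra u\<close>; with \<open>R\<close> the identity, it is the squared norm.\<close>

definition qform :: "complex^'n^'n \<Rightarrow> complex^'n \<Rightarrow> real" where
  "qform R u = Re (cdot u (R *v u))"

lemma qform_scale: "qform R (c *s u) = (cmod c)\<^sup>2 * qform R u"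
proof -
  have "cdot (c *s u) (R *v (c *s u)) = of_real ((cmod c)\<^sup>2) * cdot u (R *v u)"
    unfolding complex_norm_square by (simp add: vector_scalar_commute cdot_scale_left cdot_scale_right mult_ac)
  then show ?thesis by (simp add: qform_def)
qed

lemma qform_real_combination:
  assumes "psd R"
  shows "qform R (of_real \<alpha> *s u + of_real \<beta> *s v)
    = \<alpha>\<^sup>2 * qform R u + \<beta>\<^sup>2 * qform R v + 2 * \<alpha> * \<beta> * Re (cdot u (R *v v))"
  unfolding qform_def
  by (simp add: cdot_add_left cdot_add_right cdot_scale_left cdot_scale_right psd_hermitian[OF assms, of v u]
      matrix_vector_right_distrib vector_scalar_commute power2_eq_square algebra_simps)

lemma ketbra_real_combination_diff:
  "ketbra (of_real \<alpha> *s u + of_real \<beta> *s v) - ketbra (of_real \<beta> *s u + of_real \<alpha> *s v)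
    = (\<alpha>\<^sup>2 - \<beta>\<^sup>2) *\<^sub>R (ketbra u - ketbra v)"
  by (simp add: vec_eq_iff ketbra_def scaleR_conv_of_real[where 'a = complex] power2_eq_square algebra_simps)

locale purity_form =
  fixes R :: "complex^'n^'n" and F :: "complex^'n^'n \<Rightarrow> complex^'n^'n \<Rightarrow> real"
  assumes psd_R: "psd R"
    and bilinear: "bilinear F"
    and sym: "F X Y = F Y X"
    and nonneg: "0 \<le> F (ketbra u) (ketbra v)"
    and le_qform: "F (ketbra u) (ketbra u) \<le> (qform R u)\<^sup>2"
begin

lemma F_diff: "F (X - Y) (X - Y) = F X X + F Y Y - 2 * F X Y"
  by (simp add: bilinear_lsub[OF bilinear] bilinear_rsub[OF bilinear] sym[of Y X])

lemma F_scale: "F (a *\<^sub>R X) (b *\<^sub>R Y) = a * b * F X Y"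
  by (simp add: bilinear_lmul[OF bilinear] bilinear_rmul[OF bilinear])

lemma qform_nonneg: "0 \<le> qform R u"
  unfolding qform_def by (rule psdD(1)[OF psd_R])

text \<open>Both combinations have the same \<open>qform\<close> value. In the expansion of
  \<open>F\<close> on their difference the cross term is dropped by \<open>nonneg\<close> and the
  diagonal terms are bounded by \<open>le_qform\<close>; \<alpha> and \<beta> stay free for
  optimization.\<close>

lemma combination_bound:
  assumes "qform R u = 1" and "qform R v = 1" and "Re (cdot u (R *v v)) = g"
  shows "(\<alpha>\<^sup>2 - \<beta>\<^sup>2)\<^sup>2 * F (ketbra u - ketbra v) (ketbra u - ketbra v) \<le> 2 * (\<alpha>\<^sup>2 + \<beta>\<^sup>2 + 2 * \<alpha> * \<beta> * g)\<^sup>2"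
proof -
  define a b where "a = of_real \<alpha> *s u + of_real \<beta> *s v" and "b = of_real \<beta> *s u + of_real \<alpha> *s v"
  have "(\<alpha>\<^sup>2 - \<beta>\<^sup>2)\<^sup>2 * F (ketbra u - ketbra v) (ketbra u - ketbra v) = F (ketbra a - ketbra b) (ketbra a - ketbra b)"
    unfolding a_def b_def ketbra_real_combination_diff F_scale by (simp add: power2_eq_square)
  also have "\<dots> \<le> (qform R a)\<^sup>2 + (qform R b)\<^sup>2"
    unfolding F_diff using nonneg[of a b] le_qform[of a] le_qform[of b] by simp
  also have "\<dots> = 2 * (\<alpha>\<^sup>2 + \<beta>\<^sup>2 + 2 * \<alpha> * \<beta> * g)\<^sup>2"
    unfolding a_def b_def qform_real_combination[OF psd_R] using assms by (simp add: algebra_simps)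
  finally show ?thesis .
qed

text \<open>With \<open>h = sqrt (1 - g\<^sup>2)\<close>, the coefficients \<open>\<alpha> = 1 + h\<close>, \<open>\<beta> = - g\<close> make the two combinations
  in the previous lemma orthogonal with respect to \<open>R\<close>; they degenerate for \<open>g = 1\<close>, which is treated as a limit.\<close>

lemma normalized_pair_bound:
  assumes "qform R u = 1" and "qform R v = 1" and "cdot u (R *v v) = of_real g" and "0 \<le> g"
  shows "F (ketbra u - ketbra v) (ketbra u - ketbra v) \<le> 2 * (1 - g\<^sup>2)"
proof -
  let ?D = "F (ketbra u - ketbra v) (ketbra u - ketbra v)"
  have bound: "(\<alpha>\<^sup>2 - \<beta>\<^sup>2)\<^sup>2 * ?D \<le> 2 * (\<alpha>\<^sup>2 + \<beta>\<^sup>2 + 2 * \<alpha> * \<beta> * g)\<^sup>2" for \<alpha> \<beta>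
    by (rule combination_bound) (use assms in auto)
  have "g\<^sup>2 \<le> 1"
    using psd_Cauchy_Schwarz[OF psd_R, of u v] assms by (simp add: qform_def)
  show ?thesis
  proof (cases "g\<^sup>2 = 1")
    case True
    then have "g = 1" using assms(4) by (simp add: power2_eq_1_iff)
    have "?D \<le> 0"
    proof (rule ccontr)
      assume "\<not> ?D \<le> 0"
      \<comment> \<open>The coefficients below satisfy \<alpha> + \<beta> = \<delta> and \<alpha> -
        \<beta> = 2, so the bound reads 4 \<delta>^4 \<le> 2 \<delta>^4.\<close>
      define \<delta> where "\<delta> = sqrt ?D"
      have \<delta>: "\<delta>\<^sup>2 = ?D" "0 < \<delta>" using \<open>\<not> ?D \<le> 0\<close> by (simp_all add: \<delta>_def)
      have "(2 * \<delta>)\<^sup>2 * \<delta>\<^sup>2 \<le> 2 * (\<delta>\<^sup>2)\<^sup>2"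
        using bound[of "(2 + \<delta>) / 2" "(\<delta> - 2) / 2"] unfolding \<open>g = 1\<close> \<delta>(1)[symmetric]
        by (simp add: power2_eq_square field_simps)
      with \<delta>(2) show False by (simp add: power2_eq_square)
    qed
    with True show ?thesis by simp
  next
    case False
    define h where "h = sqrt (1 - g\<^sup>2)"
    have h: "0 < h" and g: "g\<^sup>2 = 1 - h\<^sup>2" using False \<open>g\<^sup>2 \<le> 1\<close> by (simp_all add: h_def)
    \<comment> \<open>The common \<open>qform\<close> value exceeds \<alpha>^2 - \<beta>^2 = 2h(1 +
      h) by exactly a factor \<open>h\<close>, which leaves 2h^2 after division.\<close>
    have "(1 + h)\<^sup>2 + (- g)\<^sup>2 + 2 * (1 + h) * (- g) * g = (1 + h)\<^sup>2 - (1 + 2 * h) * g\<^sup>2"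
      by (simp add: power2_eq_square algebra_simps)
    also have "\<dots> = 2 * h * (1 + h) * h"
      unfolding g by (simp add: power2_eq_square algebra_simps)
    finally have e: "(1 + h)\<^sup>2 + (- g)\<^sup>2 + 2 * (1 + h) * (- g) * g = 2 * h * (1 + h) * h"
      "(1 + h)\<^sup>2 - (- g)\<^sup>2 = 2 * h * (1 + h)"
      using g by (simp_all add: power2_eq_square algebra_simps)
    have "(2 * h * (1 + h))\<^sup>2 * ?D \<le> (2 * h * (1 + h))\<^sup>2 * (2 * h\<^sup>2)"
      using bound[of "1 + h" "- g"] unfolding e power_mult_distrib[of _ h] by (simp only: mult_ac)
    then have "?D \<le> 2 * h\<^sup>2"
      using h by (subst (asm) mult_le_cancel_left_pos) auto
    then show ?thesis using g by simp
  qed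
qed

text \<open>Homogeneous form of the previous bound: \<open>u\<close> and \<open>v\<close> are
  rescaled to unit \<open>qform\<close>, a phase makes their overlap real and nonnegative, and the
  result is multiplied by half the product of the two \<open>qform\<close> values.\<close>

lemma pair_bound:
  "(qform R v * (F (ketbra u) (ketbra u) / qform R u) + qform R u * (F (ketbra v) (ketbra v) / qform R v)) / 2
     - F (ketbra u) (ketbra v) \<le> qform R u * qform R v - (cmod (cdot u (R *v v)))\<^sup>2"
proof (cases "qform R u = 0 \<or> qform R v = 0")
  case True
  \<comment> \<open>In the degenerate case the overlap vanishes, and division by zero also removes
    both diagonal terms, leaving only - F \<le> 0.\<close>
  then have "(cmod (cdot u (R *v v)))\<^sup>2 = 0"
    using psd_Cauchy_Schwarz[OF psd_R, of u v] by (auto simp: qform_def)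
  then show ?thesis using True nonneg[of u v] by auto
next
  case False
  then have pos: "0 < qform R u" "0 < qform R v" using qform_nonneg by (simp_all add: less_le)
  define p q z where "p = qform R u" and "q = qform R v" and "z = cdot u (R *v v)"
  define c where "c = (if z = 0 then 1 else cnj z / of_real (cmod z))"
  have c: "cmod c = 1" "c * z = of_real (cmod z)"
    by (auto simp: c_def norm_divide mult.commute[of "cnj z"] power2_eq_square simp flip: complex_norm_square)
  define u' v' where "u' = of_real (1 / sqrt p) *s u" and "v' = (c * of_real (1 / sqrt q)) *s v"
  have kb: "ketbra u' = (1 / p) *\<^sub>R ketbra u" "ketbra v' = (1 / q) *\<^sub>R ketbra v"
    unfolding u'_def v'_def ketbra_scale using c pos
    by (simp_all add: norm_mult norm_divide power_divide p_def q_def)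
  have "F (ketbra u' - ketbra v') (ketbra u' - ketbra v') \<le> 2 * (1 - (cmod z / sqrt (p * q))\<^sup>2)"
  proof (rule normalized_pair_bound)
    show "qform R u' = 1" "qform R v' = 1"
      unfolding u'_def v'_def qform_scale using c pos
      by (simp_all add: norm_mult norm_divide power_divide p_def q_def)
    have "cdot u' (R *v v') = of_real (1 / sqrt p) * of_real (1 / sqrt q) * (c * z)"
      by (simp add: u'_def v'_def z_def vector_scalar_commute cdot_scale_left cdot_scale_right)
    then show "cdot u' (R *v v') = of_real (cmod z / sqrt (p * q))"
      unfolding c by (simp add: real_sqrt_mult)
  qed (use pos in \<open>simp add: p_def q_def\<close>)
  then have "p * q / 2 * (F (ketbra u') (ketbra u') + F (ketbra v') (ketbra v') - 2 * F (ketbra u') (ketbra v'))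
     \<le> p * q / 2 * (2 * (1 - (cmod z / sqrt (p * q))\<^sup>2))"
    unfolding F_diff using pos by (intro mult_left_mono) (auto simp: p_def q_def)
  also have "p * q / 2 * (2 * (1 - (cmod z / sqrt (p * q))\<^sup>2)) = p * q - (cmod z)\<^sup>2"
    using pos[folded p_def q_def] by (simp add: power_divide field_simps)
  also have "p * q / 2 * (F (ketbra u') (ketbra u') + F (ketbra v') (ketbra v') - 2 * F (ketbra u') (ketbra v'))
     = (q * (F (ketbra u) (ketbra u) / p) + p * (F (ketbra v) (ketbra v) / q)) / 2 - F (ketbra u) (ketbra v)"
    unfolding kb F_scale using pos[folded p_def q_def] by (simp add: field_simps)
  finally show ?thesis
    unfolding p_def q_def z_def .
qed

text \<open>For X_j = \<open>ketbra (u j)\<close> / p_j with weights p_j =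
  \<open>qform R (u j)\<close>, summing \<open>pair_bound\<close> over all ordered pairs gives the
  variance identity: half the weighted mean of F(X_j - X_k, X_j - X_k) is the mean of F(X_j, X_j)
  minus F(M, M).\<close>

theorem sum_purity_le:
  assumes "finite K" and "(\<Sum>k\<in>K. qform R (u k)) = 1"
  defines "M \<equiv> \<Sum>k\<in>K. ketbra (u k)"
  shows "(\<Sum>k\<in>K. F (ketbra (u k)) (ketbra (u k)) / qform R (u k)) \<le> F M M + 1 - Re (trace (R ** M ** R ** M))"
proof -
  define p where "p k = qform R (u k)" for k
  define f where "f j k = F (ketbra (u j)) (ketbra (u k))" for j k
  have p1: "(\<Sum>k\<in>K. p k) = 1" using assms(2) by (simp add: p_def)
  have FM: "F M M = (\<Sum>j\<in>K. \<Sum>k\<in>K. f j k)"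
    unfolding M_def bilinear_sum[OF bilinear] by (simp add: f_def sum.cartesian_product)
  have "Re (trace (R ** M ** R ** M)) = (\<Sum>j\<in>K. \<Sum>k\<in>K. Re (trace (R ** ketbra (u k) ** R ** ketbra (u j))))"
    by (simp add: M_def linear_sum[OF linear_matrix_mult_right] linear_sum[OF linear_matrix_mult_left]
        linear_sum[OF linear_Re_trace])
  also have "\<dots> = (\<Sum>j\<in>K. \<Sum>k\<in>K. (cmod (cdot (u j) (R *v u k)))\<^sup>2)"
    unfolding trace_mult_ketbra2
    by (intro sum.cong refl)
      (subst (2) psd_hermitian[OF psd_R], simp flip: complex_norm_square)
  finally have tr: "Re (trace (R ** M ** R ** M)) = (\<Sum>j\<in>K. \<Sum>k\<in>K. (cmod (cdot (u j) (R *v u k)))\<^sup>2)" .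
  have "(\<Sum>j\<in>K. \<Sum>k\<in>K. (p k * (f j j / p j) + p j * (f k k / p k)) / 2 - f j k)
     \<le> (\<Sum>j\<in>K. \<Sum>k\<in>K. p j * p k - (cmod (cdot (u j) (R *v u k)))\<^sup>2)"
    unfolding p_def f_def by (intro sum_mono pair_bound)
  moreover have "(\<Sum>j\<in>K. \<Sum>k\<in>K. p j * p k) = 1"
    using p1 by (simp flip: sum_product)
  moreover have "(\<Sum>j\<in>K. \<Sum>k\<in>K. p k * (f j j / p j)) = (\<Sum>j\<in>K. f j j / p j)"
    "(\<Sum>j\<in>K. \<Sum>k\<in>K. p j * (f k k / p k)) = (\<Sum>j\<in>K. f j j / p j)"
    by (simp_all only: sum_distrib_right[symmetric] sum_distrib_left[symmetric] p1 mult_1_left)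
  ultimately have "(\<Sum>j\<in>K. f j j / p j) - F M M \<le> 1 - Re (trace (R ** M ** R ** M))"
    by (simp add: sum_subtractf sum.distrib FM tr flip: sum_divide_distrib)
  then show ?thesis by (simp add: f_def p_def)
qed

end

subsection \<open>Conditional operators of a bipartite state\<close>

lemma sum_UNIV_prod: "(\<Sum>x\<in>(UNIV :: ('a::finite \<times> 'b::finite) set). f x) = (\<Sum>i\<in>UNIV. \<Sum>j\<in>UNIV. f (i, j))"
  by (simp add: sum.cartesian_product flip: UNIV_Times_UNIV)

text \<open>For a POVM element \<open>X\<close> this is the post-measurement state times its
  probability; without normalisation it stays linear in \<open>X\<close>.\<close>

definition cond_op :: "complex^('a::finite \<times> 'b::finite)^('a \<times> 'b) \<Rightarrow> complex^'a^'a \<Rightarrow> complex^'b^'b" where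
  "cond_op \<rho> X = tr_fst (tensor X (mat 1) ** \<rho>)"

lemma tensor_one_mult_entry:
  "(tensor X (mat 1) ** \<rho>) $ (i, j) $ y = (\<Sum>k\<in>UNIV. X $ i $ k * \<rho> $ (k, j) $ y)"
proof -
  have *: "a * (if j = l then 1 else 0) * b = (if j = l then a * b else 0)" for a b :: complex and l
    by simp
  show ?thesis
    by (simp add: matrix_matrix_mult_def tensor_def sum_UNIV_prod mat_def *)
qed

lemma cond_op_entry:
  "cond_op \<rho> X $ j $ j' = (\<Sum>i\<in>UNIV. \<Sum>k\<in>UNIV. X $ i $ k * \<rho> $ (k, j) $ (i, j'))"
  by (simp add: cond_op_def tr_fst_def tensor_one_mult_entry)

lemma linear_tensor_one: "linear (\<lambda>X. tensor X (mat 1))"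
  by (rule linearI) (simp_all add: tensor_def vec_eq_iff algebra_simps scaleR_conv_of_real[where 'a = complex])

lemma linear_cond_op: "linear (cond_op \<rho>)"
  by (rule linearI)
    (simp_all add: vec_eq_iff cond_op_entry algebra_simps sum.distrib sum_distrib_left
      scaleR_conv_of_real[where 'a = complex])

lemma tensor_one: "tensor (mat 1) (mat 1) = mat 1"
  by (auto simp: tensor_def mat_def vec_eq_iff prod_eq_iff)

lemma cond_op_one: "cond_op \<rho> (mat 1) = tr_fst \<rho>"
  by (simp add: cond_op_def tensor_one)

lemma trace_tr_fst: "trace (tr_fst \<rho>) = trace \<rho>"
  unfolding trace_def by (simp add: tr_fst_def sum_UNIV_prod) (rule sum.swap)

lemma trace_cond_op: "trace (cond_op \<rho> X) = trace (X ** tr_snd \<rho>)"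
proof -
  have "trace (cond_op \<rho> X) = (\<Sum>j\<in>UNIV. \<Sum>i\<in>UNIV. \<Sum>k\<in>UNIV. X $ i $ k * \<rho> $ (k, j) $ (i, j))"
    by (simp add: trace_def cond_op_entry)
  also have "\<dots> = (\<Sum>i\<in>UNIV. \<Sum>j\<in>UNIV. \<Sum>k\<in>UNIV. X $ i $ k * \<rho> $ (k, j) $ (i, j))"
    by (rule sum.swap)
  also have "\<dots> = (\<Sum>i\<in>UNIV. \<Sum>k\<in>UNIV. \<Sum>j\<in>UNIV. X $ i $ k * \<rho> $ (k, j) $ (i, j))"
    by (intro sum.cong refl sum.swap)
  finally show ?thesis
    by (simp add: trace_mult tr_snd_def sum_distrib_left)
qed

definition tensor_vec :: "complex^'a \<Rightarrow> complex^'b \<Rightarrow> complex^('a \<times> 'b)" where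
  "tensor_vec u w = (\<chi> x. u $ fst x * w $ snd x)"

text \<open>Reduces positivity of the conditional operator for a rank-one effect to that of \<rho>
  on product vectors. The sums are only reordered to group the indices into pairs.\<close>

lemma cdot_cond_op_ketbra:
  "cdot w (cond_op \<rho> (ketbra u) *v w) = cdot (tensor_vec u w) (\<rho> *v tensor_vec u w)"
proof -
  let ?f = "\<lambda>j j' i k. cnj (w $ j) * (u $ i * cnj (u $ k) * \<rho> $ (k, j) $ (i, j')) * w $ j'"
  have "cdot w (cond_op \<rho> (ketbra u) *v w)
      = (\<Sum>j\<in>UNIV. \<Sum>j'\<in>UNIV. \<Sum>i\<in>UNIV. \<Sum>k\<in>UNIV. ?f j j' i k)"
    by (simp add: cdot_mat_vec cond_op_entry ketbra_def sum_distrib_left sum_distrib_right)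
  also have "\<dots> = (\<Sum>j\<in>UNIV. \<Sum>j'\<in>UNIV. \<Sum>k\<in>UNIV. \<Sum>i\<in>UNIV. ?f j j' i k)"
    by (intro sum.cong refl sum.swap)
  also have "\<dots> = (\<Sum>j\<in>UNIV. \<Sum>k\<in>UNIV. \<Sum>j'\<in>UNIV. \<Sum>i\<in>UNIV. ?f j j' i k)"
    by (intro sum.cong refl sum.swap)
  also have "\<dots> = (\<Sum>j\<in>UNIV. \<Sum>k\<in>UNIV. \<Sum>i\<in>UNIV. \<Sum>j'\<in>UNIV. ?f j j' i k)"
    by (intro sum.cong refl sum.swap)
  also have "\<dots> = (\<Sum>k\<in>UNIV. \<Sum>j\<in>UNIV. \<Sum>i\<in>UNIV. \<Sum>j'\<in>UNIV. ?f j j' i k)"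
    by (rule sum.swap)
  also have "\<dots> = cdot (tensor_vec u w) (\<rho> *v tensor_vec u w)"
    unfolding cdot_mat_vec sum_UNIV_prod by (simp add: tensor_vec_def mult_ac)
  finally show ?thesis .
qed

lemma psd_cond_op:
  fixes X :: "complex^'a::finite^'a"
  assumes "psd \<rho>" and "psd X"
  shows "psd (cond_op \<rho> X)"
proof -
  obtain w :: "'a \<Rightarrow> complex^'a" where w: "X = (\<Sum>i\<in>UNIV. ketbra (w i))"
    by (rule psd_eq_sum_ketbra[OF assms(2)])
  have "psd (cond_op \<rho> (ketbra u))" for u
    using assms(1) by (simp add: psd_def cdot_cond_op_ketbra)
  then show ?thesis
    unfolding w linear_sum[OF linear_cond_op] by (intro psd_sum)
qed

lemma psd_mat_1: "psd (mat 1)"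
  using cdot_commute by (intro psdI) (simp_all add: cdot_def sum_nonneg)

lemma psd_tr_snd:
  assumes "psd \<rho>"
  shows "psd (tr_snd \<rho>)"
proof -
  have "cdot u (tr_snd \<rho> *v u) = trace (cond_op \<rho> (ketbra u))" for u
    unfolding trace_cond_op by (subst trace_mul_sym) (simp add: trace_mult_ketbra)
  then show ?thesis
    by (intro psdI) (simp_all add: Re_trace_psd_nonneg Im_trace_psd psd_cond_op psd_ketbra assms)
qed

lemma qform_tr_snd: "qform (tr_snd \<rho>) u = Re (trace (cond_op \<rho> (ketbra u)))"
  unfolding trace_cond_op qform_def by (subst trace_mul_sym) (simp add: trace_mult_ketbra)

text \<open>Resolving the identity in the standard basis shows that the operator is
  positive.\<close>

lemma tensor_ketbra_one:
  "tensor (ketbra v) (mat 1) = (\<Sum>l\<in>UNIV. ketbra (tensor_vec v (axis l 1 :: complex^'b)))"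
proof -
  have "(\<Sum>l\<in>UNIV. v $ i * axis l 1 $ j * cnj (v $ k * (axis l 1 :: complex^'b) $ m))
      = (\<Sum>l\<in>UNIV. if l = j then (if j = m then v $ i * cnj (v $ k) else 0) else 0)" for i k j m
    by (intro sum.cong) (auto simp: axis_def)
  then show ?thesis
    by (auto simp: vec_eq_iff tensor_def ketbra_def tensor_vec_def mat_def)
qed

lemma psd_conjugate:
  assumes "psd \<rho>" and "psd Y"
  shows "psd (\<rho> ** Y ** \<rho>)"
proof -
  have "cdot w (\<rho> *v x) = cdot (\<rho> *v w) x" for w x
    by (metis psd_hermitian[OF assms(1)] cdot_commute)
  then show ?thesis
    using assms(2) by (simp add: psd_def flip: matrix_vector_mul_assoc)
qed

text \<open>A rank-one effect factorises the product, \<open>c\<close> being the contraction of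
  \<rho> with the bra of \<open>u\<close>. Hence the two forms used for measurements agree on
  rank-one diagonals, although at the identity one gives the purity of \<rho> and the other that of
  its marginal on b.\<close>

lemma trace_tensor_ketbra_square:
  "trace (tensor (ketbra u) (mat 1) ** \<rho> ** tensor (ketbra u) (mat 1) ** \<rho>)
     = trace (cond_op \<rho> (ketbra u) ** cond_op \<rho> (ketbra u))"
proof -
  define c where "c j y = (\<Sum>k\<in>UNIV. cnj (u $ k) * \<rho> $ (k, j) $ y)" for j y
  have T: "(tensor (ketbra u) (mat 1) ** \<rho>) $ (i, j) $ y = u $ i * c j y" for i j y
    by (simp add: tensor_one_mult_entry c_def ketbra_def sum_distrib_left mult_ac)
  have B: "cond_op \<rho> (ketbra u) $ j $ l = (\<Sum>i\<in>UNIV. u $ i * c j (i, l))" for j l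
    by (simp add: cond_op_entry c_def ketbra_def sum_distrib_left mult_ac)
  let ?f = "\<lambda>i j k l. (u $ i * c j (k, l)) * (u $ k * c l (i, j))"
  have "trace ((tensor (ketbra u) (mat 1) ** \<rho>) ** (tensor (ketbra u) (mat 1) ** \<rho>))
      = (\<Sum>i\<in>UNIV. \<Sum>j\<in>UNIV. \<Sum>k\<in>UNIV. \<Sum>l\<in>UNIV. ?f i j k l)"
    unfolding trace_mult by (simp add: sum_UNIV_prod T)
  also have "\<dots> = (\<Sum>j\<in>UNIV. \<Sum>i\<in>UNIV. \<Sum>k\<in>UNIV. \<Sum>l\<in>UNIV. ?f i j k l)"
    by (rule sum.swap)
  also have "\<dots> = (\<Sum>j\<in>UNIV. \<Sum>i\<in>UNIV. \<Sum>l\<in>UNIV. \<Sum>k\<in>UNIV. ?f i j k l)"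
    by (intro sum.cong refl sum.swap)
  also have "\<dots> = (\<Sum>j\<in>UNIV. \<Sum>l\<in>UNIV. \<Sum>i\<in>UNIV. \<Sum>k\<in>UNIV. ?f i j k l)"
    by (intro sum.cong refl sum.swap)
  also have "\<dots> = (\<Sum>j\<in>UNIV. \<Sum>l\<in>UNIV. \<Sum>k\<in>UNIV. \<Sum>i\<in>UNIV. ?f i j k l)"
    by (intro sum.cong refl sum.swap)
  also have "\<dots> = trace (cond_op \<rho> (ketbra u) ** cond_op \<rho> (ketbra u))"
    unfolding trace_mult B by (simp add: sum_product mult_ac)
  finally show ?thesis by (simp add: matrix_mul_assoc)
qed

subsection \<open>Measurements\<close>

text \<open>Cauchy-Schwarz in the form expressing joint convexity of x^2 / p.\<close>

lemma norm_sum_square_div_le: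
  fixes x :: "'i \<Rightarrow> 'v::real_normed_vector"
  assumes "finite I" and "\<And>i. i \<in> I \<Longrightarrow> norm (x i) \<le> p i"
  shows "(norm (\<Sum>i\<in>I. x i))\<^sup>2 / (\<Sum>i\<in>I. p i) \<le> (\<Sum>i\<in>I. (norm (x i))\<^sup>2 / p i)"
proof -
  have p: "0 \<le> p i" if "i \<in> I" for i
    using assms(2)[OF that] norm_ge_zero order_trans by blast
  \<comment> \<open>This splitting survives \<open>p i = 0\<close>, since then
    \<open>x i = 0\<close> by assumption.\<close>
  have x: "norm (x i) = norm (x i) / sqrt (p i) * sqrt (p i)" if "i \<in> I" for i
    using assms(2)[OF that] by (cases "p i = 0") auto
  have "(norm (\<Sum>i\<in>I. x i))\<^sup>2 \<le> (\<Sum>i\<in>I. norm (x i))\<^sup>2"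
    by (intro power_mono norm_sum) simp
  also have "\<dots> = (\<Sum>i\<in>I. norm (x i) / sqrt (p i) * sqrt (p i))\<^sup>2"
    using x by (intro arg_cong[where f = "\<lambda>t. t\<^sup>2"] sum.cong) auto
  also have "\<dots> \<le> (\<Sum>i\<in>I. (norm (x i) / sqrt (p i))\<^sup>2) * (\<Sum>i\<in>I. (sqrt (p i))\<^sup>2)"
    by (rule Cauchy_Schwarz_ineq_sum)
  also have "\<dots> = (\<Sum>i\<in>I. (norm (x i))\<^sup>2 / p i) * (\<Sum>i\<in>I. p i)"
    using p by (intro arg_cong2[where f = "(*)"] sum.cong) (auto simp: power_divide)
  finally have *: "(norm (\<Sum>i\<in>I. x i))\<^sup>2 \<le> (\<Sum>i\<in>I. (norm (x i))\<^sup>2 / p i) * (\<Sum>i\<in>I. p i)" .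
  moreover have "0 \<le> (\<Sum>i\<in>I. p i)" "0 \<le> (\<Sum>i\<in>I. (norm (x i))\<^sup>2 / p i)"
    using p by (auto intro!: sum_nonneg)
  ultimately show ?thesis
    by (cases "(\<Sum>i\<in>I. p i) = 0") (simp_all add: field_simps)
qed

lemma Re_trace_scaleR_square: "Re (trace ((r *\<^sub>R A) ** (r *\<^sub>R A))) = r\<^sup>2 * Re (trace (A ** A))"
  by (simp add: linear_scale[OF linear_matrix_mult_right] linear_scale[OF linear_matrix_mult_left]
      linear_scale[OF linear_Re_trace] power2_eq_square)

text \<open>The constant parts of the entropies cancel because the probabilities sum to one.
  Outcomes of probability zero have zero conditional operator, so the sum extends to all of
  \<open>J\<close>.\<close>

lemma chi_Q_eq:
  assumes \<rho>: "density_op \<rho>" and P: "povm J P"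
  shows "chi_Q J P \<rho> = (\<Sum>j\<in>J. (norm (cond_op \<rho> (P j)))\<^sup>2 / Re (trace (cond_op \<rho> (P j))))
    - Re (trace (tr_fst \<rho> ** tr_fst \<rho>))"
proof -
  define p where "p j = Re (trace (cond_op \<rho> (P j)))" for j
  define J' where "J' = {j \<in> J. p j \<noteq> 0}"
  have fin: "finite J" and one: "(\<Sum>j\<in>J. P j) = mat 1" and psd_P: "\<And>j. j \<in> J \<Longrightarrow> psd (P j)"
    using P by (auto simp: povm_def)
  have psd_c: "psd (cond_op \<rho> (P j))" if "j \<in> J" for j
    using \<rho> that by (intro psd_cond_op psd_P) (simp_all add: density_op_def)
  have zero: "cond_op \<rho> (P j) = 0" if "j \<in> J" "p j = 0" for j
    using norm_psd_le_trace[OF psd_c[OF that(1)]] that(2) by (simp add: p_def)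
  have prob: "outcome_prob P \<rho> = p"
    by (rule ext) (simp add: outcome_prob_def p_def trace_cond_op)
  have post: "post_state P \<rho> = (\<lambda>j. (1 / p j) *\<^sub>R cond_op \<rho> (P j))"
    by (rule ext) (simp add: post_state_def cond_op_def prob)
  have total: "(\<Sum>j\<in>J. cond_op \<rho> (P j)) = tr_fst \<rho>"
    by (simp add: one cond_op_one flip: linear_sum[OF linear_cond_op])
  have "(\<Sum>j\<in>J. p j) = Re (trace (tr_fst \<rho>))"
    by (simp add: p_def total flip: linear_sum[OF linear_Re_trace])
  then have p1: "(\<Sum>j\<in>J. p j) = 1"
    using \<rho> by (simp add: trace_tr_fst density_op_def)
  have "(\<Sum>j\<in>J'. p j *\<^sub>R (1 / p j) *\<^sub>R cond_op \<rho> (P j)) = (\<Sum>j\<in>J. cond_op \<rho> (P j))"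
    using fin zero by (intro sum.mono_neutral_cong_left) (auto simp: J'_def)
  then have avg: "(\<Sum>j\<in>J'. p j *\<^sub>R (1 / p j) *\<^sub>R cond_op \<rho> (P j)) = tr_fst \<rho>"
    by (simp only: total)
  have "(\<Sum>j\<in>J'. p j * S_Q ((1 / p j) *\<^sub>R cond_op \<rho> (P j)))
      = (\<Sum>j\<in>J. p j - (norm (cond_op \<rho> (P j)))\<^sup>2 / p j)"
    using fin
    by (intro sum.mono_neutral_cong_left)
      (auto simp: J'_def S_Q_def Re_trace_scaleR_square norm_psd_square[OF psd_c] field_simps power2_eq_square[of "p _"]
        simp del: scaleR_scaleR)
  then show ?thesis
    unfolding chi_Q_def holevo_Q_def prob post J'_def[symmetric] avg
    by (simp add: p1 S_Q_def[of "tr_fst \<rho>"] sum_subtractf p_def[symmetric])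
qed

text \<open>Splitting every POVM element into rank-one parts does not decrease \<open>\<chi>\<close>, so the bound
  for rank-one elements carries over.\<close>

lemma chi_Q_le:
  fixes \<rho> :: "complex^('a::finite \<times> 'b::finite)^('a \<times> 'b)" and J :: "'i set"
  assumes \<rho>: "density_op \<rho>" and P: "povm J P"
    and F: "purity_form (tr_snd \<rho>) F"
    and F_ketbra: "\<And>u. F (ketbra u) (ketbra u) = (norm (cond_op \<rho> (ketbra u)))\<^sup>2"
  shows "chi_Q J P \<rho> \<le> F (mat 1) (mat 1) + 1 - Re (trace (tr_snd \<rho> ** tr_snd \<rho>))
    - Re (trace (tr_fst \<rho> ** tr_fst \<rho>))"
proof -
  interpret purity_form "tr_snd \<rho>" F by (rule F)
  have fin: "finite J" and one: "(\<Sum>j\<in>J. P j) = mat 1" and psd_P: "\<And>j. j \<in> J \<Longrightarrow> psd (P j)"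
    using P by (auto simp: povm_def)
  have "\<forall>j\<in>J. \<exists>w :: 'a \<Rightarrow> complex^'a. P j = (\<Sum>i\<in>UNIV. ketbra (w i))"
    using psd_eq_sum_ketbra[OF psd_P] by metis
  from bchoice[OF this] obtain w :: "'i \<Rightarrow> 'a \<Rightarrow> complex^'a"
    where w: "\<And>j. j \<in> J \<Longrightarrow> P j = (\<Sum>i\<in>UNIV. ketbra (w j i))"
    by blast
  define u where "u = (\<lambda>(j, i). w j i)"
  have M: "(\<Sum>k\<in>J \<times> UNIV. ketbra (u k)) = mat 1"
    using w one by (simp add: u_def sum.cartesian_product')
  have "(\<Sum>k\<in>J \<times> UNIV. qform (tr_snd \<rho>) (u k)) = Re (trace (cond_op \<rho> (mat 1)))"
    unfolding qform_tr_snd M[symmetric] by (simp add: linear_sum[OF linear_cond_op] linear_sum[OF linear_Re_trace])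
  also have "\<dots> = 1" using \<rho> by (simp add: cond_op_one trace_tr_fst density_op_def)
  finally have "(\<Sum>k\<in>J \<times> UNIV. F (ketbra (u k)) (ketbra (u k)) / qform (tr_snd \<rho>) (u k))
      \<le> F (mat 1) (mat 1) + 1 - Re (trace (tr_snd \<rho> ** tr_snd \<rho>))"
    using sum_purity_le[of "J \<times> UNIV" u] fin by (simp add: M)
  moreover have "(norm (cond_op \<rho> (P j)))\<^sup>2 / Re (trace (cond_op \<rho> (P j)))
     \<le> (\<Sum>i\<in>UNIV. F (ketbra (w j i)) (ketbra (w j i)) / qform (tr_snd \<rho>) (w j i))" if "j \<in> J" for j
    unfolding F_ketbra qform_tr_snd w[OF that] linear_sum[OF linear_cond_op] linear_sum[OF linear_Re_trace]
    using \<rho> by (intro norm_sum_square_div_le norm_psd_le_trace psd_cond_op psd_ketbra) (auto simp: density_op_def)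
  then have "(\<Sum>j\<in>J. (norm (cond_op \<rho> (P j)))\<^sup>2 / Re (trace (cond_op \<rho> (P j))))
     \<le> (\<Sum>k\<in>J \<times> UNIV. F (ketbra (u k)) (ketbra (u k)) / qform (tr_snd \<rho>) (u k))"
    unfolding u_def by (simp add: sum_mono sum.cartesian_product')
  ultimately show ?thesis
    unfolding chi_Q_eq[OF \<rho> P] by linarith
qed

lemma bilinear_Re_trace_mult:
  assumes "linear f" and "linear g"
  shows "bilinear (\<lambda>X Y. Re (trace (f X ** g Y :: complex^'n^'n)))"
  unfolding bilinear_def
  using linear_compose[OF linear_compose[OF assms(1) linear_matrix_mult_left] linear_Re_trace]
    linear_compose[OF linear_compose[OF assms(2) linear_matrix_mult_right] linear_Re_trace]
  by (auto simp: o_def)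

text \<open>At the identity this form equals the purity of \<rho>, so the bound of
  \<open>chi_Q_le\<close> is exactly the mutual information.\<close>

lemma chi_Q_le_mutual_info_Q:
  assumes "density_op \<rho>" and "povm J P"
  shows "chi_Q J P \<rho> \<le> mutual_info_Q \<rho>"
proof -
  let ?T = "\<lambda>X. tensor X (mat 1) ** \<rho>"
  let ?F = "\<lambda>X Y. Re (trace (?T X ** ?T Y))"
  have psd: "psd \<rho>" using assms(1) by (simp add: density_op_def)
  have F_ketbra: "?F (ketbra u) (ketbra u) = (norm (cond_op \<rho> (ketbra u)))\<^sup>2" for u
    using psd_cond_op[OF psd psd_ketbra]
    by (simp add: norm_psd_square matrix_mul_assoc trace_tensor_ketbra_square)
  have "linear ?T"
    using linear_compose[OF linear_tensor_one linear_matrix_mult_left] by (simp add: o_def)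
  have "purity_form (tr_snd \<rho>) ?F"
  proof
    show "psd (tr_snd \<rho>)" by (rule psd_tr_snd[OF psd])
    show "bilinear ?F" by (intro bilinear_Re_trace_mult \<open>linear ?T\<close>)
    show "?F X Y = ?F Y X" for X Y by (subst trace_mul_sym) simp
    show "0 \<le> ?F (ketbra u) (ketbra v)" for u v
    proof -
      \<comment> \<open>The form is read as the trace of a product of two positive operators, the
        second being one effect conjugated by \<rho>.\<close>
      have "psd (tensor (ketbra z) (mat 1))" for z
        unfolding tensor_ketbra_one by (intro psd_sum psd_ketbra)
      then have "0 \<le> Re (trace (tensor (ketbra u) (mat 1) ** (\<rho> ** tensor (ketbra v) (mat 1) ** \<rho>)))"
        by (intro Re_trace_psd_mult_nonneg psd_conjugate psd)
      then show ?thesis by (simp add: matrix_mul_assoc)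
    qed
    show "?F (ketbra u) (ketbra u) \<le> (qform (tr_snd \<rho>) u)\<^sup>2" for u
      unfolding F_ketbra qform_tr_snd
      by (intro power_mono norm_psd_le_trace psd_cond_op psd psd_ketbra) simp
  qed
  from chi_Q_le[OF assms this F_ketbra] show ?thesis
    by (simp add: mutual_info_Q_def S_Q_def tensor_one)
qed

text \<open>Here the form at the identity is the purity of the marginal on b, which cancels the last
  term of \<open>chi_Q_le\<close>.\<close>

lemma chi_Q_le_S_Q:
  assumes "density_op \<rho>" and "povm J P"
  shows "chi_Q J P \<rho> \<le> S_Q (tr_snd \<rho>)"
proof -
  let ?F = "\<lambda>X Y. Re (trace (cond_op \<rho> X ** cond_op \<rho> Y))"
  have psd: "psd \<rho>" using assms(1) by (simp add: density_op_def)
  have F_ketbra: "?F (ketbra u) (ketbra u) = (norm (cond_op \<rho> (ketbra u)))\<^sup>2" for u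
    using psd_cond_op[OF psd psd_ketbra] by (simp add: norm_psd_square)
  have "purity_form (tr_snd \<rho>) ?F"
  proof
    show "psd (tr_snd \<rho>)" by (rule psd_tr_snd[OF psd])
    show "bilinear ?F" by (intro bilinear_Re_trace_mult linear_cond_op)
    show "?F X Y = ?F Y X" for X Y by (subst trace_mul_sym) simp
    show "0 \<le> ?F (ketbra u) (ketbra v)" for u v
      by (intro Re_trace_psd_mult_nonneg psd_cond_op psd psd_ketbra)
    show "?F (ketbra u) (ketbra u) \<le> (qform (tr_snd \<rho>) u)\<^sup>2" for u
      unfolding F_ketbra qform_tr_snd
      by (intro power_mono norm_psd_le_trace psd_cond_op psd psd_ketbra) simp
  qed
  from chi_Q_le[OF assms this F_ketbra] show ?thesis
    by (simp add: S_Q_def cond_op_one)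
qed

subsection \<open>Pure states\<close>

lemma cdot_self: "cdot v v = of_real ((norm v)\<^sup>2)"
proof -
  have "cdot v v = (\<Sum>i\<in>UNIV. of_real ((cmod (v $ i))\<^sup>2))"
    unfolding cdot_def complex_norm_square by (simp add: mult.commute)
  then show ?thesis
    by (simp add: norm_vec_def L2_set_def sum_nonneg)
qed

lemma trace_ketbra: "trace (ketbra v) = of_real ((norm v)\<^sup>2)"
  unfolding cdot_self[symmetric] by (simp add: trace_def ketbra_def cdot_def mult.commute)

lemma trace_ketbra_square: "trace (ketbra v ** ketbra v) = (trace (ketbra v))\<^sup>2"
  unfolding trace_mult_ketbra cdot_ketbra trace_ketbra cdot_self by (simp add: power2_eq_square)

lemma density_op_ketbra: "norm v = 1 \<Longrightarrow> density_op (ketbra v)"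
  by (simp add: density_op_def psd_ketbra trace_ketbra)

lemma cond_op_ketbra_ketbra:
  "cond_op (ketbra \<psi>) (ketbra u) = ketbra (\<chi> j. \<Sum>i\<in>UNIV. cnj (u $ i) * \<psi> $ (i, j))"
proof -
  have "cond_op (ketbra \<psi>) (ketbra u) $ j $ l
     = (\<Sum>k\<in>UNIV. \<Sum>i\<in>UNIV. (cnj (u $ k) * \<psi> $ (k, j)) * (u $ i * cnj (\<psi> $ (i, l))))" for j l
    by (subst sum.swap) (simp add: cond_op_entry ketbra_def mult_ac)
  then show ?thesis
    by (simp add: vec_eq_iff ketbra_def sum_product)
qed

text \<open>Both sides are the same fourfold sum over the coefficients of \<psi>, read in different
  orders.\<close>

lemma trace_tr_fst_square_ketbra:
  "trace (tr_fst (ketbra \<psi>) ** tr_fst (ketbra \<psi>)) = trace (tr_snd (ketbra \<psi>) ** tr_snd (ketbra \<psi>))"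
proof -
  let ?f = "\<lambda>j l i k. (\<psi> $ (i, j) * cnj (\<psi> $ (i, l))) * (\<psi> $ (k, l) * cnj (\<psi> $ (k, j)))"
  have "trace (tr_fst (ketbra \<psi>) ** tr_fst (ketbra \<psi>))
      = (\<Sum>j\<in>UNIV. \<Sum>l\<in>UNIV. \<Sum>i\<in>UNIV. \<Sum>k\<in>UNIV. ?f j l i k)"
    by (simp add: trace_mult tr_fst_def ketbra_def sum_product)
  also have "\<dots> = (\<Sum>j\<in>UNIV. \<Sum>i\<in>UNIV. \<Sum>l\<in>UNIV. \<Sum>k\<in>UNIV. ?f j l i k)"
    by (intro sum.cong refl sum.swap)
  also have "\<dots> = (\<Sum>i\<in>UNIV. \<Sum>j\<in>UNIV. \<Sum>l\<in>UNIV. \<Sum>k\<in>UNIV. ?f j l i k)"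
    by (rule sum.swap)
  also have "\<dots> = (\<Sum>i\<in>UNIV. \<Sum>j\<in>UNIV. \<Sum>k\<in>UNIV. \<Sum>l\<in>UNIV. ?f j l i k)"
    by (intro sum.cong refl sum.swap)
  also have "\<dots> = (\<Sum>i\<in>UNIV. \<Sum>k\<in>UNIV. \<Sum>j\<in>UNIV. \<Sum>l\<in>UNIV. ?f j l i k)"
    by (intro sum.cong refl sum.swap)
  also have "\<dots> = trace (tr_snd (ketbra \<psi>) ** tr_snd (ketbra \<psi>))"
    by (simp add: trace_mult tr_snd_def ketbra_def sum_product mult_ac)
  finally show ?thesis .
qed

text \<open>A rank-one measurement on one side of a pure state leaves the other side pure.\<close>

lemma chi_Q_pure_state:
  assumes "pure_state \<rho>" and N: "rank1_povm J N"
  shows "chi_Q J N \<rho> = S_Q (tr_snd \<rho>)"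
proof -
  obtain \<psi> where \<psi>: "norm \<psi> = 1" "\<rho> = ketbra \<psi>"
    using assms(1) by (auto simp: pure_state_def)
  have \<rho>: "density_op \<rho>" using \<psi> density_op_ketbra by simp
  have povm: "povm J N" using N by (simp add: rank1_povm_def)
  \<comment> \<open>The conditional operator has the form \<open>ketbra \<phi>\<close>, whose
    squared norm is its squared trace; 0 / 0 = 0 covers a zero operator.\<close>
  have "(norm (cond_op \<rho> (N j)))\<^sup>2 / Re (trace (cond_op \<rho> (N j))) = Re (trace (cond_op \<rho> (N j)))" if "j \<in> J" for j
  proof -
    obtain w where "N j = ketbra w"
      using psd_rank1_eq_ketbra[of "N j"] N \<open>j \<in> J\<close> by (auto simp: rank1_povm_def povm_def)
    then obtain \<phi> where "cond_op \<rho> (N j) = ketbra \<phi>"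
      by (simp add: \<psi>(2) cond_op_ketbra_ketbra)
    then show ?thesis
      by (simp add: norm_psd_square psd_ketbra trace_ketbra_square) (simp add: trace_ketbra power2_eq_square)
  qed
  then have "(\<Sum>j\<in>J. (norm (cond_op \<rho> (N j)))\<^sup>2 / Re (trace (cond_op \<rho> (N j)))) = (\<Sum>j\<in>J. Re (trace (cond_op \<rho> (N j))))"
    by simp
  also have "\<dots> = Re (trace (tr_fst \<rho>))"
    using povm by (simp add: povm_def cond_op_one flip: linear_sum[OF linear_cond_op] linear_sum[OF linear_Re_trace])
  also have "\<dots> = 1" using \<rho> by (simp add: trace_tr_fst density_op_def)
  finally show ?thesis
    unfolding chi_Q_eq[OF \<rho> povm] by (simp add: S_Q_def \<psi>(2) trace_tr_fst_square_ketbra)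
qed

lemma density_op_tr_third:
  assumes "pure_state \<rho>"
  shows "density_op (tr_third \<rho>)"
proof -
  obtain \<psi> where \<psi>: "norm \<psi> = 1" "\<rho> = ketbra \<psi>"
    using assms by (auto simp: pure_state_def)
  have "tr_third \<rho> = (\<Sum>k\<in>UNIV. ketbra (\<chi> x. \<psi> $ (fst x, snd x, k)))"
    by (simp add: vec_eq_iff tr_third_def \<psi>(2) ketbra_def)
  moreover have "trace (tr_third \<rho>) = trace \<rho>"
    by (simp add: trace_def tr_third_def sum_UNIV_prod)
  ultimately show ?thesis
    using density_op_ketbra[OF \<psi>(1)] \<psi>(2) by (simp add: density_op_def psd_sum psd_ketbra)
qed

lemma tr_snd_tr_third: "tr_snd (tr_third \<rho>) = tr_snd \<rho>"
  by (simp add: vec_eq_iff tr_snd_def tr_third_def sum_UNIV_prod)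

subsection \<open>Channels\<close>

lemma quantum_channel_linear:
  assumes "quantum_channel E"
  shows "linear E"
proof (rule linearI)
  show "E (A + B) = E A + E B" for A B
    using assms by (simp add: quantum_channel_def complex_linear_map_def)
  have scale: "mat (of_real r) ** A = r *\<^sub>R A" for r and A :: "complex^'k^'k"
    by (simp add: vec_eq_iff matrix_matrix_mult_def mat_def if_distrib[where f = "\<lambda>x. x * z" for z]
        scaleR_conv_of_real[where 'a = complex] cong: if_cong)
  have "E (mat (of_real r) ** A) = mat (of_real r) ** E A" for r A
    using assms by (simp add: quantum_channel_def complex_linear_map_def)
  then show "E (r *\<^sub>R A) = r *\<^sub>R E A" for r A
    by (simp add: scale)
qed

text \<open>Complete positivity at \<open>k = 1\<close>, where a block matrix is a single
  operator.\<close>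

lemma quantum_channel_psd:
  assumes "quantum_channel E" and "psd A"
  shows "psd (E A)"
proof -
  have single: "block_psd 1 (\<lambda>_ _. B) \<longleftrightarrow> psd B" for B :: "complex^'k^'k"
    unfolding block_psd_def psd_def by (auto dest: spec[where x = "\<lambda>_. v" for v])
  have "block_psd 1 (\<lambda>_ _. E A)"
    using assms single[of A] unfolding quantum_channel_def completely_positive_def by blast
  then show ?thesis using single by blast
qed

text \<open>Trace preservation yields \<open>le_qform\<close> for \<open>R = mat 1\<close>. Pure
  inputs have zero entropy, so the right side is the entropy of the average
  \<open>M\<close>.\<close>

lemma holevo_Q_channel_le:
  fixes E :: "complex^'m::finite^'m \<Rightarrow> complex^'n::finite^'n"
  assumes E: "quantum_channel E" and ens: "ensemble J p \<sigma>" and pure: "\<forall>j\<in>J. pure_state (\<sigma> j)"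
  shows "holevo_Q J p (\<lambda>j. E (\<sigma> j)) \<le> holevo_Q J p \<sigma>"
proof -
  let ?F = "\<lambda>X Y. Re (trace (E X ** E Y))"
  note lin = quantum_channel_linear[OF E]
  have tr: "trace (E A) = trace A" for A using E by (simp add: quantum_channel_def)
  have fin: "finite J" and p: "\<And>j. j \<in> J \<Longrightarrow> 0 \<le> p j" and p1: "(\<Sum>j\<in>J. p j) = 1"
    using ens by (auto simp: ensemble_def)
  have q: "qform (mat 1) u = (norm u)\<^sup>2" for u :: "complex^'m"
    by (simp add: qform_def cdot_self)
  interpret purity_form "mat 1" ?F
  proof
    show "psd (mat 1 :: complex^'m^'m)" by (rule psd_mat_1)
    show "bilinear ?F" by (intro bilinear_Re_trace_mult lin)
    show "?F X Y = ?F Y X" for X Y by (subst trace_mul_sym) simp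
    show "0 \<le> ?F (ketbra u) (ketbra v)" for u v
      by (intro Re_trace_psd_mult_nonneg quantum_channel_psd[OF E] psd_ketbra)
    have "?F (ketbra u) (ketbra u) = (norm (E (ketbra u)))\<^sup>2" for u
      by (intro norm_psd_square[symmetric] quantum_channel_psd[OF E] psd_ketbra)
    moreover have "norm (E (ketbra u)) \<le> qform (mat 1) u" for u
      using norm_psd_le_trace[OF quantum_channel_psd[OF E psd_ketbra, of u]] by (simp add: tr trace_ketbra q)
    ultimately show "?F (ketbra u) (ketbra u) \<le> (qform (mat 1) u)\<^sup>2" for u
      by (simp add: power_mono)
  qed
  from bchoice[OF pure[unfolded pure_state_def]]
  obtain \<psi> where \<psi>: "\<And>j. j \<in> J \<Longrightarrow> norm (\<psi> j) = 1 \<and> \<sigma> j = ketbra (\<psi> j)"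
    by blast
  \<comment> \<open>Absorbing the weight into the vector makes its \<open>qform\<close> equal to
    \<open>p j\<close>.\<close>
  define u where "u j = of_real (sqrt (p j)) *s \<psi> j" for j
  define M where "M = (\<Sum>j\<in>J. p j *\<^sub>R \<sigma> j)"
  have kb: "ketbra (u j) = p j *\<^sub>R \<sigma> j" if "j \<in> J" for j
    using \<psi>[OF that] p[OF that] by (simp add: u_def ketbra_scale)
  have qu: "qform (mat 1) (u j) = p j" if "j \<in> J" for j
    using \<psi>[OF that] p[OF that] by (simp add: u_def qform_scale q)
  have M: "(\<Sum>j\<in>J. ketbra (u j)) = M"
    using kb by (simp add: M_def)
  have "(\<Sum>j\<in>J. ?F (ketbra (u j)) (ketbra (u j)) / qform (mat 1) (u j)) \<le> ?F M M + 1 - Re (trace (M ** M))"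
    using sum_purity_le[OF fin, of u] qu p1 by (simp add: M)
  moreover have "?F (ketbra (u j)) (ketbra (u j)) / qform (mat 1) (u j) = p j * ?F (\<sigma> j) (\<sigma> j)" if "j \<in> J" for j
    unfolding kb[OF that] F_scale qu[OF that] by simp
  ultimately have "(\<Sum>j\<in>J. p j * ?F (\<sigma> j) (\<sigma> j)) \<le> ?F M M + 1 - Re (trace (M ** M))"
    by simp
  moreover have "S_Q (\<sigma> j) = 0" if "j \<in> J" for j
    using \<psi>[OF that] by (simp add: S_Q_def trace_ketbra_square) (simp add: trace_ketbra)
  then have "holevo_Q J p \<sigma> = 1 - Re (trace (M ** M))"
    by (simp add: holevo_Q_def M_def S_Q_def[of "sum _ _"])
  moreover have "(\<Sum>j\<in>J. p j *\<^sub>R E (\<sigma> j)) = E M"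
    by (simp add: M_def linear_sum[OF lin] linear_scale[OF lin])
  then have "holevo_Q J p (\<lambda>j. E (\<sigma> j)) = (\<Sum>j\<in>J. p j * ?F (\<sigma> j) (\<sigma> j)) - ?F M M"
    by (simp add: holevo_Q_def S_Q_def right_diff_distrib sum_subtractf p1)
  ultimately show ?thesis by simp
qed

section \<open>The four properties together\<close>

theorem theorem5:
  shows
    "(\<forall>(\<rho> :: complex^('a::finite \<times> 'b::finite)^('a \<times> 'b)) (J :: 'i set) P.
        density_op \<rho> \<longrightarrow> povm J P \<longrightarrow> mutual_info_Q \<rho> \<ge> chi_Q J P \<rho>)
   \<and> (\<forall>(\<rho> :: complex^('a \<times> 'b)^('a \<times> 'b)) (J :: 'i set) P.
        density_op \<rho> \<longrightarrow> povm J P \<longrightarrow> chi_Q J P \<rho> \<le> S_Q (tr_snd \<rho>))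
   \<and> (\<forall>(\<rho> :: complex^('a \<times> 'b \<times> 'c::finite)^('a \<times> 'b \<times> 'c)) (J :: 'i set) N.
        pure_state \<rho> \<longrightarrow> rank1_povm J N \<longrightarrow> chi_Q J N (tr_third \<rho>) \<le> chi_Q J N \<rho>)
   \<and> (\<forall>(E :: complex^'m::finite^'m \<Rightarrow> complex^'n::finite^'n) (J :: 'i set) p \<sigma>.
        quantum_channel E \<longrightarrow> ensemble J p \<sigma> \<longrightarrow> (\<forall>j\<in>J. pure_state (\<sigma> j)) \<longrightarrow>
        holevo_Q J p (\<lambda>j. E (\<sigma> j)) \<le> holevo_Q J p \<sigma>)"
proof (intro conjI allI impI)
  fix \<rho> :: "complex^('a \<times> 'b \<times> 'c)^('a \<times> 'b \<times> 'c)" and J :: "'i set" and N :: "'i \<Rightarrow> complex^'a^'a"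
  assume "pure_state \<rho>" and "rank1_povm J N"
  then show "chi_Q J N (tr_third \<rho>) \<le> chi_Q J N \<rho>"
    using chi_Q_le_S_Q[OF density_op_tr_third, of \<rho> J N]
    by (simp add: chi_Q_pure_state tr_snd_tr_third rank1_povm_def)
qed (simp_all add: chi_Q_le_mutual_info_Q chi_Q_le_S_Q holevo_Q_channel_le)

end
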